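(* Let $G$ be a finite group, $X$ a $G$-metric space, $Y$ a compact $G$-metric space, and $\psi:Y\to X$ a $G$-function (a $G$-equivariant, not necessarily continuous, function). Then $$\delta(\psi)\ \ge\ c_\infty^G(X,Y;0).$$
   Context: A $G$-metric space is a (nonempty) metric space with a left $G$-action by isometries; a $G$-map is a continuous $G$-equivariant function; $\inf\emptyset=+\infty$. The modulus of discontinuity $\delta(\psi)$ is the infimum of all numbers $\delta>0$ such that every point of $Y$ has a neighborhood whose image under $\psi$ has diameter at most $\delta$. For $\eta>0$, $\mathrm{VR}^{\mathrm m}_\infty(X;\eta)$ is the space of finitely supported Borel probability measures on $X$ whose support has diameter $<\eta$, with the weak topology and the push-forward $G$-action. $c_\infty^G(X,Y;0):=\inf\{\eta>0:\text{there is a }G\text{-map }Y\to\mathrm{VR}^{\mathrm m}_\infty(X;\eta)\}$. *)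

theory Defs
  imports "HOL-Probability.Probability" "HOL-Algebra.Group_Action"
begin

text \<open>
  Metric spaces are types of class \<open>metric_space\<close> (hence nonempty). A left action of \<open>G\<close> on such
  a space is a \<open>group_action\<close> on the whole type.
\<close>

definition G_metric_space :: "('g, 'r) monoid_scheme \<Rightarrow> ('g \<Rightarrow> 'a::metric_space \<Rightarrow> 'a) \<Rightarrow> bool"
  where "G_metric_space G \<alpha> \<longleftrightarrow>
    group_action G UNIV \<alpha> \<and> (\<forall>g\<in>carrier G. \<forall>x y. dist (\<alpha> g x) (\<alpha> g y) = dist x y)"

definition G_equivariant ::
  "('g, 'r) monoid_scheme \<Rightarrow> ('g \<Rightarrow> 'b \<Rightarrow> 'b) \<Rightarrow> ('g \<Rightarrow> 'c \<Rightarrow> 'c) \<Rightarrow> ('b \<Rightarrow> 'c) \<Rightarrow> bool"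
  where "G_equivariant G \<beta> \<gamma> f \<longleftrightarrow> (\<forall>g\<in>carrier G. \<forall>y. f (\<beta> g y) = \<gamma> g (f y))"

text \<open>
  Boundedness is required explicitly because \<open>diameter\<close> is real-valued and unspecified on
  unbounded sets. The infimum is taken in the extended reals, where \<open>Inf {} = \<infinity>\<close>.
\<close>

definition modulus_of_discontinuity :: "('b::metric_space \<Rightarrow> 'a::metric_space) \<Rightarrow> ereal"
  where "modulus_of_discontinuity \<psi> =
    Inf (ereal ` {\<delta>. 0 < \<delta> \<and>
      (\<forall>y. \<exists>U. open U \<and> y \<in> U \<and> bounded (\<psi> ` U) \<and> diameter (\<psi> ` U) \<le> \<delta>)})"

definition borel_prob_measures :: "'a::topological_space measure set"
  where "borel_prob_measures = {\<mu>. prob_space \<mu> \<and> sets \<mu> = sets borel}"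

definition measure_support :: "'a::topological_space measure \<Rightarrow> 'a set"
  where "measure_support \<mu> = {x. \<forall>U. open U \<and> x \<in> U \<longrightarrow> emeasure \<mu> U > 0}"

text \<open>
  A measure on a non-separable space need not be concentrated on its support, so being finitely
  supported includes the requirement that the finite support carries the full mass.
\<close>

definition finitely_supported :: "'a::topological_space measure \<Rightarrow> bool"
  where "finitely_supported \<mu> \<longleftrightarrow>
    finite (measure_support \<mu>) \<and> emeasure \<mu> (measure_support \<mu>) = 1"

text \<open>The coarsest topology making \<open>\<mu> \<mapsto> \<integral>f d\<mu>\<close> continuous for all bounded continuous real \<open>f\<close>.\<close>

definition weak_topology :: "'a::topological_space measure topology"
  where "weak_topology = topology_generated_by
    {{\<mu> \<in> borel_prob_measures. (\<integral>x. f x \<partial>\<mu>) \<in> V} | (f :: 'a \<Rightarrow> real) V.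
       continuous_on UNIV f \<and> bounded (range f) \<and> open V}"

definition VRm_infty :: "real \<Rightarrow> 'a::metric_space measure set"
  where "VRm_infty \<eta> =
    {\<mu> \<in> borel_prob_measures. finitely_supported \<mu> \<and> diameter (measure_support \<mu>) < \<eta>}"

definition VRm_infty_topology :: "real \<Rightarrow> 'a::metric_space measure topology"
  where "VRm_infty_topology \<eta> = subtopology weak_topology (VRm_infty \<eta>)"

definition push_forward :: "('g \<Rightarrow> 'a \<Rightarrow> 'a) \<Rightarrow> 'g \<Rightarrow> 'a::topological_space measure \<Rightarrow> 'a measure"
  where "push_forward \<alpha> g \<mu> = distr \<mu> borel (\<alpha> g)"

text \<open>
  The number \<open>c\<^sub>\<infinity>\<^sup>G(X,Y;0)\<close>, where \<open>\<alpha>\<close> and \<open>\<beta>\<close> are the actions of \<open>G\<close> on \<open>X\<close> and \<open>Y\<close>;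
  the spaces themselves are given by the types.
\<close>

definition c_infty_0 ::
  "('g, 'r) monoid_scheme \<Rightarrow> ('g \<Rightarrow> 'a::metric_space \<Rightarrow> 'a) \<Rightarrow> ('g \<Rightarrow> 'b::metric_space \<Rightarrow> 'b) \<Rightarrow> ereal"
  where "c_infty_0 G \<alpha> \<beta> =
    Inf (ereal ` {\<eta>. 0 < \<eta> \<and>
      (\<exists>f. continuous_map euclidean (VRm_infty_topology \<eta>) f \<and>
           G_equivariant G \<beta> (push_forward \<alpha>) f)})"

end

theory Submission
  imports Defs
begin

text \<open>
  Let \<open>\<delta>\<close> be a number admitted by the modulus of discontinuity of \<open>\<psi>\<close>. Compactness of \<open>Y\<close> makes
  the local bounds uniform: there is \<open>\<epsilon> > 0\<close> such that \<open>\<psi>\<close> maps every \<open>\<epsilon>\<close>-ball onto a set of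
  diameter at most \<open>\<delta>\<close> (\<open>uniform_image_diameter_bound\<close>). Choose a finite subset \<open>F\<close> of \<open>Y\<close> whose
  \<open>\<epsilon>\<close>-balls cover \<open>Y\<close>; since \<open>G\<close> is finite, \<open>F\<close> may be replaced by the union of its translates and
  hence be taken \<open>G\<close>-invariant (\<open>finite_invariant_net\<close>).

  The functions \<open>\<epsilon> - d(y, p)\<close>, cut off at \<open>0\<close> and normalized, form a partition of unity indexed by
  \<open>p \<in> F\<close> and subordinate to these balls. Send \<open>y\<close> to the convex combination of the Dirac masses at
  the points \<open>\<psi>(p)\<close> with these coefficients. Although \<open>\<psi>\<close> is discontinuous, this map is continuous,
  because only the coefficients depend on \<open>y\<close> and \<open>\<psi>\<close> is evaluated at finitely many fixed points.
  Its value at \<open>y\<close> is supported in the image of the \<open>\<epsilon>\<close>-ball about \<open>y\<close>, so that the support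
  has diameter at most \<open>\<delta>\<close>. It is equivariant because \<open>G\<close> permutes \<open>F\<close> and acts by isometries.
  Therefore every \<open>\<eta> > \<delta>\<close> is admitted in the infimum that defines \<open>c\<^sub>\<infinity>\<^sup>G(X,Y;0)\<close>.
\<close>

section \<open>Finite combinations of Dirac masses\<close>

definition atomic_measure ::
  "'i set \<Rightarrow> ('i \<Rightarrow> real) \<Rightarrow> ('i \<Rightarrow> 'a::topological_space) \<Rightarrow> 'a measure"
  where "atomic_measure I w v = distr (point_measure I (\<lambda>i. ennreal (w i))) borel v"

lemma sets_atomic_measure [simp]: "sets (atomic_measure I w v) = sets borel"
  by (simp add: atomic_measure_def)

lemma space_atomic_measure [simp]: "space (atomic_measure I w v) = UNIV"
  by (simp add: atomic_measure_def)

lemma emeasure_atomic_measure: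
  assumes "finite I" "A \<in> sets borel"
  shows "emeasure (atomic_measure I w v) A = (\<Sum>i\<in>{i\<in>I. v i \<in> A}. ennreal (w i))"
proof -
  have "emeasure (atomic_measure I w v) A
      = emeasure (point_measure I (\<lambda>i. ennreal (w i))) {i\<in>I. v i \<in> A}"
    unfolding atomic_measure_def using assms
    by (subst emeasure_distr) (auto simp: space_point_measure vimage_def Int_def conj_commute)
  then show ?thesis
    using assms by (simp add: emeasure_point_measure_finite)
qed

lemma integral_atomic_measure:
  fixes f :: "'a::topological_space \<Rightarrow> real"
  assumes "finite I" "\<And>i. i \<in> I \<Longrightarrow> 0 \<le> w i" "f \<in> borel_measurable borel"
  shows "(\<integral>x. f x \<partial>atomic_measure I w v) = (\<Sum>i\<in>I. w i * f (v i))"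
  unfolding atomic_measure_def using assms
  by (subst integral_distr) (auto simp: lebesgue_integral_point_measure_finite)

lemma atomic_measure_in_borel_prob_measures:
  assumes "finite I" "\<And>i. i \<in> I \<Longrightarrow> 0 \<le> w i" "(\<Sum>i\<in>I. w i) = 1"
  shows "atomic_measure I w v \<in> borel_prob_measures"
  unfolding borel_prob_measures_def
  using assms by (auto intro!: prob_spaceI simp: emeasure_atomic_measure)

lemma measure_support_atomic_measure:
  fixes v :: "'i \<Rightarrow> 'a::t1_space"
  assumes "finite I"
  shows "measure_support (atomic_measure I w v) = v ` {i\<in>I. 0 < w i}"
proof (intro equalityI subsetI)
  fix x assume x: "x \<in> measure_support (atomic_measure I w v)"
  show "x \<in> v ` {i\<in>I. 0 < w i}"
  proof (rule ccontr)
    assume "x \<notin> v ` {i\<in>I. 0 < w i}"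
    moreover have "open (- v ` {i\<in>I. 0 < w i})"
      using assms by (intro open_Compl finite_imp_closed) auto
    ultimately have "0 < emeasure (atomic_measure I w v) (- v ` {i\<in>I. 0 < w i})"
      using x by (auto simp: measure_support_def)
    moreover have "emeasure (atomic_measure I w v) (- v ` {i\<in>I. 0 < w i}) = 0"
      using assms \<open>open _\<close>
      by (subst emeasure_atomic_measure) (auto simp: not_less ennreal_eq_0_iff)
    ultimately show False by simp
  qed
next
  fix x assume "x \<in> v ` {i\<in>I. 0 < w i}"
  then obtain i where i: "i \<in> I" "0 < w i" "x = v i" by auto
  show "x \<in> measure_support (atomic_measure I w v)"
    unfolding measure_support_def
  proof safe
    fix U assume U: "open U" "x \<in> U"
    have "ennreal (w i) \<le> (\<Sum>j\<in>{j\<in>I. v j \<in> U}. ennreal (w j))"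
      using assms i U by (intro member_le_sum) auto
    with i have "0 < (\<Sum>j\<in>{j\<in>I. v j \<in> U}. ennreal (w j))"
      by (metis ennreal_less_zero_iff less_le_trans)
    then show "0 < emeasure (atomic_measure I w v) U"
      using assms U by (simp add: emeasure_atomic_measure)
  qed
qed

lemma finitely_supported_atomic_measure:
  fixes v :: "'i \<Rightarrow> 'a::t1_space"
  assumes "finite I" "\<And>i. i \<in> I \<Longrightarrow> 0 \<le> w i" "(\<Sum>i\<in>I. w i) = 1"
  shows "finitely_supported (atomic_measure I w v)"
proof -
  let ?S = "v ` {i\<in>I. 0 < w i}"
  have "?S \<in> sets borel"
    using assms by (intro borel_closed finite_imp_closed) auto
  then have "emeasure (atomic_measure I w v) ?S = (\<Sum>i\<in>{i\<in>I. v i \<in> ?S}. ennreal (w i))"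
    using assms by (simp add: emeasure_atomic_measure)
  also have "\<dots> = (\<Sum>i\<in>I. ennreal (w i))"
    using assms by (intro sum.mono_neutral_left) (auto simp: ennreal_eq_0_iff not_less[symmetric])
  also have "\<dots> = 1"
    using assms by simp
  finally show ?thesis
    using assms by (simp add: finitely_supported_def measure_support_atomic_measure)
qed

lemma distr_atomic_measure:
  assumes "f \<in> borel_measurable borel"
  shows "distr (atomic_measure I w v) borel f = atomic_measure I w (f \<circ> v)"
  unfolding atomic_measure_def using assms by (subst distr_distr) auto

lemma atomic_measure_reindex:
  assumes "finite I" "bij_betw h I I" "\<And>i. i \<in> I \<Longrightarrow> w' (h i) = w i" "\<And>i. i \<in> I \<Longrightarrow> v' (h i) = v i"
  shows "atomic_measure I w' v' = atomic_measure I w v"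
proof (rule measure_eqI)
  fix A assume "A \<in> sets (atomic_measure I w' v')"
  then have A: "A \<in> sets borel" by simp
  have "bij_betw h {i\<in>I. v i \<in> A} {i\<in>I. v' i \<in> A}"
    using assms(2,4) unfolding bij_betw_def inj_on_def
    by (auto simp: image_iff) (metis imageE)
  then have "(\<Sum>i\<in>{i\<in>I. v i \<in> A}. ennreal (w' (h i))) = (\<Sum>i\<in>{i\<in>I. v' i \<in> A}. ennreal (w' i))"
    by (rule sum.reindex_bij_betw)
  then show "emeasure (atomic_measure I w' v') A = emeasure (atomic_measure I w v) A"
    using assms A by (simp add: emeasure_atomic_measure)
qed simp

text \<open>
  The atoms \<open>v i\<close> do not move with \<open>y\<close>: the integral of a test function is a linear form in the
  weights whose coefficients are constants, and it inherits continuity from the weights.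
\<close>

lemma continuous_map_atomic_measure:
  fixes w :: "'y::topological_space \<Rightarrow> 'i \<Rightarrow> real"
  assumes "finite I" "\<And>y i. i \<in> I \<Longrightarrow> 0 \<le> w y i" "\<And>y. (\<Sum>i\<in>I. w y i) = 1"
    and "\<And>i. i \<in> I \<Longrightarrow> continuous_on UNIV (\<lambda>y. w y i)"
  shows "continuous_map euclidean weak_topology (\<lambda>y. atomic_measure I (w y) v)"
  unfolding weak_topology_def
proof (rule continuous_on_generated_topo)
  have P: "atomic_measure I (w y) v \<in> borel_prob_measures" for y
    using assms by (intro atomic_measure_in_borel_prob_measures) auto
  show "(\<lambda>y. atomic_measure I (w y) v) ` topspace euclidean \<subseteq>
    \<Union> {{\<mu> \<in> borel_prob_measures. (\<integral>x. f x \<partial>\<mu>) \<in> V} | (f :: 'a \<Rightarrow> real) V.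
       continuous_on UNIV f \<and> bounded (range f) \<and> open V}"
  proof -
    have "borel_prob_measures \<in> {{\<mu> \<in> borel_prob_measures. (\<integral>x. f x \<partial>\<mu>) \<in> V} |
       (f :: 'a \<Rightarrow> real) V. continuous_on UNIV f \<and> bounded (range f) \<and> open V}"
      by (rule CollectI, rule exI[of _ "\<lambda>_. 0"], rule exI[of _ UNIV]) auto
    with P show ?thesis by blast
  qed
  fix U assume "U \<in> {{\<mu> \<in> borel_prob_measures. (\<integral>x. f x \<partial>\<mu>) \<in> V} | (f :: 'a \<Rightarrow> real) V.
       continuous_on UNIV f \<and> bounded (range f) \<and> open V}"
  then obtain f :: "'a \<Rightarrow> real" and V where
    U: "U = {\<mu> \<in> borel_prob_measures. (\<integral>x. f x \<partial>\<mu>) \<in> V}"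
    and f: "continuous_on UNIV f" and V: "open V" by blast
  have "f \<in> borel_measurable borel"
    using f by (rule borel_measurable_continuous_onI)
  then have "(\<lambda>y. atomic_measure I (w y) v) -` U = (\<lambda>y. \<Sum>i\<in>I. w y i * f (v i)) -` V"
    using assms P by (auto simp: U integral_atomic_measure)
  moreover have "continuous_on UNIV (\<lambda>y. \<Sum>i\<in>I. w y i * f (v i))"
    using assms by (intro continuous_intros) auto
  ultimately show "openin euclidean ((\<lambda>y. atomic_measure I (w y) v) -` U \<inter> topspace euclidean)"
    using V by (simp add: open_vimage)
qed

section \<open>Uniform bounds and invariant nets on compact spaces\<close>

lemma uniform_image_diameter_bound:
  fixes \<psi> :: "'b::metric_space \<Rightarrow> 'a::metric_space"
  assumes "compact (UNIV :: 'b set)"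
    and "\<forall>y. \<exists>U. open U \<and> y \<in> U \<and> bounded (\<psi> ` U) \<and> diameter (\<psi> ` U) \<le> \<delta>"
  obtains \<epsilon> where "0 < \<epsilon>" "\<And>y S. S \<subseteq> \<psi> ` ball y \<epsilon> \<Longrightarrow> diameter S \<le> \<delta>"
proof -
  let ?C = "{U. open U \<and> bounded (\<psi> ` U) \<and> diameter (\<psi> ` U) \<le> \<delta>}"
  have "UNIV \<subseteq> \<Union> ?C"
    using assms(2) by blast
  then obtain \<epsilon> where \<epsilon>: "0 < \<epsilon>" "\<And>y. \<exists>U\<in>?C. ball y \<epsilon> \<subseteq> U"
    using Heine_Borel_lemma[OF assms(1), of ?C] by (metis (lifting) UNIV_I mem_Collect_eq)
  show thesis
  proof (rule that[OF \<epsilon>(1)])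
    fix y S assume S: "S \<subseteq> \<psi> ` ball y \<epsilon>"
    obtain U where U: "U \<in> ?C" "ball y \<epsilon> \<subseteq> U"
      using \<epsilon>(2) by blast
    with S have "S \<subseteq> \<psi> ` U" by blast
    then have "diameter S \<le> diameter (\<psi> ` U)"
      using U by (intro diameter_subset) auto
    with U show "diameter S \<le> \<delta>" by simp
  qed
qed

lemma finite_invariant_net:
  fixes \<beta> :: "'g \<Rightarrow> 'b::metric_space \<Rightarrow> 'b"
  assumes "finite (carrier G)" "group_action G UNIV \<beta>" "compact (UNIV :: 'b set)" "0 < \<epsilon>"
  obtains F where "finite F" "\<And>y. \<exists>p\<in>F. dist y p < \<epsilon>"
    "\<And>g. g \<in> carrier G \<Longrightarrow> bij_betw (\<beta> g) F F"
proof -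
  interpret group_action G UNIV \<beta> by fact
  interpret group G
    using group_hom group_hom.axioms(1) by auto
  obtain K where K: "finite K" "(UNIV :: 'b set) \<subseteq> (\<Union>x\<in>K. ball x \<epsilon>)"
    using seq_compact_imp_totally_bounded assms(3,4) compact_imp_seq_compact by metis
  define F where "F = (\<Union>g\<in>carrier G. \<beta> g ` K)"
  have fin: "finite F"
    using K assms(1) by (simp add: F_def)
  have K_F: "x \<in> F" if "x \<in> K" for x
  proof -
    have "\<beta> \<one>\<^bsub>G\<^esub> x = x"
      using id_eq_one by (metis UNIV_I restrict_apply')
    then have "x \<in> \<beta> \<one>\<^bsub>G\<^esub> ` K"
      using that by (metis imageI)
    then show ?thesis
      unfolding F_def using one_closed by blast
  qed
  have net: "\<exists>p\<in>F. dist y p < \<epsilon>" for y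
  proof -
    obtain x where "x \<in> K" "y \<in> ball x \<epsilon>"
      using K(2) by blast
    with K_F show ?thesis
      by (auto simp: dist_commute intro!: bexI[of _ x])
  qed
  have bij: "bij_betw (\<beta> g) F F" if g: "g \<in> carrier G" for g
  proof -
    have "\<beta> g ` F \<subseteq> F"
    proof
      fix z assume "z \<in> \<beta> g ` F"
      then obtain h k where "h \<in> carrier G" "k \<in> K" "z = \<beta> g (\<beta> h k)"
        by (auto simp: F_def)
      then have "g \<otimes>\<^bsub>G\<^esub> h \<in> carrier G" "z = \<beta> (g \<otimes>\<^bsub>G\<^esub> h) k"
        using g by (simp_all add: composition_rule)
      with \<open>k \<in> K\<close> show "z \<in> F" unfolding F_def by blast
    qed
    moreover have "inj_on (\<beta> g) F"
      using inj_prop[OF g] by (rule inj_on_subset) simp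
    ultimately show ?thesis
      using fin by (simp add: bij_betw_def endo_inj_surj)
  qed
  show thesis
    by (rule that[OF fin net bij])
qed

section \<open>The smoothed map\<close>

text \<open>
  As functions of \<open>y\<close> these form a partition of unity subordinate to the \<open>\<epsilon>\<close>-balls about the
  points \<open>p\<close> of a finite \<open>\<epsilon>\<close>-net \<open>F\<close>. Being built from distances alone, they are preserved by
  isometries that permute \<open>F\<close>.
\<close>

definition net_weight :: "real \<Rightarrow> 'b::metric_space set \<Rightarrow> 'b \<Rightarrow> 'b \<Rightarrow> real"
  where "net_weight \<epsilon> F y p = max 0 (\<epsilon> - dist y p) / (\<Sum>q\<in>F. max 0 (\<epsilon> - dist y q))"

context
  fixes \<epsilon> :: real and F :: "'b::metric_space set"
  assumes fin: "finite F" and net: "\<And>y. \<exists>p\<in>F. dist y p < \<epsilon>"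
begin

lemma net_weight_denominator_pos: "0 < (\<Sum>q\<in>F. max 0 (\<epsilon> - dist y q))"
proof -
  obtain p where "p \<in> F" "dist y p < \<epsilon>" using net by blast
  then show ?thesis
    using fin by (intro sum_pos2[of _ p]) auto
qed

lemma net_weight_nonneg: "0 \<le> net_weight \<epsilon> F y p"
  using net_weight_denominator_pos[of y] by (simp add: net_weight_def)

lemma sum_net_weight: "(\<Sum>p\<in>F. net_weight \<epsilon> F y p) = 1"
  using net_weight_denominator_pos[of y]
  by (simp add: net_weight_def sum_divide_distrib[symmetric])

lemma net_weight_pos_imp_close: "0 < net_weight \<epsilon> F y p \<Longrightarrow> dist y p < \<epsilon>"
  by (rule ccontr) (simp add: net_weight_def)

lemma continuous_net_weight: "continuous_on UNIV (\<lambda>y. net_weight \<epsilon> F y p)"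
  unfolding net_weight_def
  using net_weight_denominator_pos by (intro continuous_intros) (simp add: less_imp_neq[symmetric])

end

lemma net_weight_invariant:
  assumes "bij_betw h F F" "\<And>x y. dist (h x) (h y) = dist x y"
  shows "net_weight \<epsilon> F (h y) (h p) = net_weight \<epsilon> F y p"
  using sum.reindex_bij_betw[OF assms(1), of "\<lambda>q. max 0 (\<epsilon> - dist (h y) q)"]
  by (simp add: net_weight_def assms(2))

text \<open>
  The discontinuous map is replaced by its local averages over a net. The strict inequality
  \<open>\<delta> < \<eta>\<close> leaves room for the strict bound on the diameters of supports in \<open>VRm_infty\<close>.
\<close>

lemma exists_G_map_to_VRm_infty:
  fixes \<psi> :: "'b::metric_space \<Rightarrow> 'a::metric_space"
  assumes "finite (carrier G)" "G_metric_space G \<alpha>" "G_metric_space G \<beta>"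
    and "compact (UNIV :: 'b set)" "G_equivariant G \<beta> \<alpha> \<psi>"
    and "\<forall>y. \<exists>U. open U \<and> y \<in> U \<and> bounded (\<psi> ` U) \<and> diameter (\<psi> ` U) \<le> \<delta>"
    and "\<delta> < \<eta>"
  shows "\<exists>f. continuous_map euclidean (VRm_infty_topology \<eta>) f \<and>
           G_equivariant G \<beta> (push_forward \<alpha>) f"
proof -
  obtain \<epsilon> where \<epsilon>: "0 < \<epsilon>" "\<And>y S. S \<subseteq> \<psi> ` ball y \<epsilon> \<Longrightarrow> diameter S \<le> \<delta>"
    using assms(4,6) by (rule uniform_image_diameter_bound) blast
  have action: "group_action G UNIV \<beta>"
    using assms(3) by (simp add: G_metric_space_def)
  obtain F where F: "finite F" "\<And>y. \<exists>p\<in>F. dist y p < \<epsilon>"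
    "\<And>g. g \<in> carrier G \<Longrightarrow> bij_betw (\<beta> g) F F"
    using assms(1) action assms(4) \<epsilon>(1) by (rule finite_invariant_net) blast
  define f where "f y = atomic_measure F (net_weight \<epsilon> F y) \<psi>" for y
  note weights = net_weight_nonneg[OF F(1,2)] sum_net_weight[OF F(1,2)]
  have "f y \<in> VRm_infty \<eta>" for y
  proof -
    have "measure_support (f y) \<subseteq> \<psi> ` ball y \<epsilon>"
      using F(1) net_weight_pos_imp_close[OF F(1,2)]
      by (auto simp: f_def measure_support_atomic_measure)
    then have "diameter (measure_support (f y)) < \<eta>"
      using \<epsilon>(2) assms(7) by (meson le_less_trans)
    moreover have "f y \<in> borel_prob_measures" "finitely_supported (f y)"
      unfolding f_def using F(1) weights
      by (auto intro!: atomic_measure_in_borel_prob_measures finitely_supported_atomic_measure)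
    ultimately show ?thesis by (simp add: VRm_infty_def)
  qed
  moreover have "continuous_map euclidean weak_topology f"
    unfolding f_def using F weights continuous_net_weight[OF F(1,2)]
    by (intro continuous_map_atomic_measure) auto
  ultimately have "continuous_map euclidean (VRm_infty_topology \<eta>) f"
    by (auto simp: VRm_infty_topology_def continuous_map_in_subtopology)
  moreover have "G_equivariant G \<beta> (push_forward \<alpha>) f"
    unfolding G_equivariant_def
  proof (intro ballI allI)
    fix g y assume g: "g \<in> carrier G"
    have isom: "dist (\<alpha> g x) (\<alpha> g x') = dist x x'" "dist (\<beta> g z) (\<beta> g z') = dist z z'" for x x' z z'
      using assms(2,3) g by (auto simp: G_metric_space_def)
    have "continuous_on UNIV (\<alpha> g)"
      unfolding continuous_on_iff isom by blast
    then have "push_forward \<alpha> g (f y) = atomic_measure F (net_weight \<epsilon> F y) (\<alpha> g \<circ> \<psi>)"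
      unfolding push_forward_def f_def
      by (intro distr_atomic_measure borel_measurable_continuous_onI)
    also have "\<dots> = f (\<beta> g y)"
      unfolding f_def
    proof (rule atomic_measure_reindex[symmetric, OF F(1) F(3)[OF g]])
      show "net_weight \<epsilon> F (\<beta> g y) (\<beta> g p) = net_weight \<epsilon> F y p" for p
        using F(3)[OF g] isom(2) by (rule net_weight_invariant)
      show "\<psi> (\<beta> g p) = (\<alpha> g \<circ> \<psi>) p" for p
        using assms(5) g by (simp add: G_equivariant_def)
    qed
    finally show "f (\<beta> g y) = push_forward \<alpha> g (f y)" ..
  qed
  ultimately show ?thesis by blast
qed

theorem proposition6p5:
  fixes G :: "('g, 'r) monoid_scheme"
    and \<alpha> :: "'g \<Rightarrow> 'a::metric_space \<Rightarrow> 'a"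
    and \<beta> :: "'g \<Rightarrow> 'b::metric_space \<Rightarrow> 'b"
    and \<psi> :: "'b \<Rightarrow> 'a"
  assumes "group G" and "finite (carrier G)"
    and "G_metric_space G \<alpha>"
    and "G_metric_space G \<beta>" and "compact (UNIV :: 'b set)"
    and "G_equivariant G \<beta> \<alpha> \<psi>"
  shows "modulus_of_discontinuity \<psi> \<ge> c_infty_0 G \<alpha> \<beta>"
  unfolding modulus_of_discontinuity_def
proof (rule Inf_greatest, safe)
  fix \<delta> :: real
  assume "0 < \<delta>"
    and \<delta>: "\<forall>y. \<exists>U. open U \<and> y \<in> U \<and> bounded (\<psi> ` U) \<and> diameter (\<psi> ` U) \<le> \<delta>"
  show "c_infty_0 G \<alpha> \<beta> \<le> ereal \<delta>"
  proof (rule ereal_le_epsilon2)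
    fix e :: real assume "0 < e"
    then have "\<exists>f. continuous_map euclidean (VRm_infty_topology (\<delta> + e)) f \<and>
           G_equivariant G \<beta> (push_forward \<alpha>) f"
      using assms \<delta> by (intro exists_G_map_to_VRm_infty[of G \<alpha> \<beta> \<psi> \<delta>]) auto
    then have "c_infty_0 G \<alpha> \<beta> \<le> ereal (\<delta> + e)"
      unfolding c_infty_0_def using \<open>0 < \<delta>\<close> \<open>0 < e\<close> by (intro Inf_lower imageI) auto
    then show "c_infty_0 G \<alpha> \<beta> \<le> ereal \<delta> + ereal e" by simp
  qed
qed

end
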